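(* Let $d \ge 1$ and let $\mathbf{S}_1, \ldots, \mathbf{S}_{d+1} \subset \mathbb{R}^d$ be pairwise disjoint sets with $|\mathbf{S}_i| = d+1$ for each $i$. Let $p \in \mathbb{R}^d$ be a point with $p \notin \bigcup_i \mathbf{S}_i$, such that the points of $\bigcup_{i=1}^{d+1}\mathbf{S}_i \cup \{p\}$ are in general position and $p \in \operatorname{int}(\operatorname{conv}(\mathbf{S}_i))$ for every $i = 1, \ldots, d+1$. Then the number of colourful simplices containing $p$ is at least $\left\lceil \frac{(d+1)^2}{2} \right\rceil$. Equivalently, $\mu(d) \ge \left\lceil \frac{(d+1)^2}{2}\right\rceil$.
   Context: A colourful simplex is the closed simplex $\operatorname{conv}\{x_1, \ldots, x_{d+1}\}$ with $x_i \in \mathbf{S}_i$ for each $i$ (one vertex from each set $\mathbf{S}_i$); distinct choices of $(x_1,\dots,x_{d+1})$ count as distinct simplices. The quantity $\mu(d)$ denotes the minimum, over all such configurations (sets $\mathbf{S}_1,\dots,\mathbf{S}_{d+1}$ of $d+1$ points each and a point $p$ in general position with $p$ in the interior of each $\operatorname{conv}(\mathbf{S}_i)$), of the number of colourful simplices containing $p$. *)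

theory Defs
  imports "HOL-Analysis.Analysis" "HOL-Library.FuncSet"
begin

definition general_position :: "(real^'n) set \<Rightarrow> bool" where
  "general_position P \<longleftrightarrow>
     (\<forall>T \<subseteq> P. card T \<le> CARD('n) + 1 \<longrightarrow> \<not> affine_dependent T)"

text \<open>Colourful simplices (as vertex choice functions, colour classes indexed by
  0..d) whose closed convex hull contains p.\<close>
definition colourful_simplices_containing ::
    "(nat \<Rightarrow> (real^'n) set) \<Rightarrow> real^'n \<Rightarrow> (nat \<Rightarrow> real^'n) set" where
  "colourful_simplices_containing S p =
     {x \<in> Pi\<^sub>E {..CARD('n)} S. p \<in> convex hull (x ` {..CARD('n)})}"

end

theory Submission
  imports Defs
begin

text \<open>A choice of one point of each colour is an edge of a \<open>(d+1)\<close>-partite hypergraph if its simplex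
  contains \<open>p\<close>. This hypergraph has no isolated vertex (colourful Caratheodory theorem), and it has
  an even number of edges in every octahedron, i.e. among the transversals of a choice of two
  points of each colour.

  The bound is a consequence of these two facts alone. Let \<open>m\<close> be the size of each colour class.
  If an edge stops being one when its vertex \<open>u\<close> is replaced by \<open>v\<close> of the same colour, then the
  degrees of \<open>u\<close> and \<open>v\<close> add up to at least \<open>m\<close>. So all vertices of degree below \<open>m/2\<close> in a colour
  are interchangeable in edges and have the same degree \<open>\<delta>\<close>, and the other vertices have degree at
  least \<open>m - \<delta>\<close>. If some colour has at most \<open>m/2\<close> low vertices, summing degrees in that colour gives
  \<open>m\<^sup>2/2\<close> edges. Otherwise no edge contains two low vertices, and the edges through the low
  vertices, more than \<open>m/2\<close> in each colour, are distinct.\<close>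

section \<open>Octahedral systems\<close>

definition octahedron :: "'i set \<Rightarrow> ('i \<Rightarrow> 'a) \<Rightarrow> ('i \<Rightarrow> 'a) \<Rightarrow> ('i \<Rightarrow> 'a) set" where
  "octahedron I x y = Pi\<^sub>E I (\<lambda>i. {x i, y i})"

lemma octahedron_cases: "f \<in> octahedron I x y \<Longrightarrow> i \<in> I \<Longrightarrow> f i = x i \<or> f i = y i"
  unfolding octahedron_def by (drule (1) PiE_mem) simp

lemma finite_octahedron: "finite I \<Longrightarrow> finite (octahedron I x y)"
  unfolding octahedron_def by (intro finite_PiE) auto

locale octahedral_system =
  fixes I :: "'i set" and V :: "'i \<Rightarrow> 'a set" and m :: nat and E :: "('i \<Rightarrow> 'a) set"
  assumes finite_I: "finite I"
    and finite_V: "i \<in> I \<Longrightarrow> finite (V i)"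
    and card_V: "i \<in> I \<Longrightarrow> card (V i) = m"
    and E_subset: "E \<subseteq> Pi\<^sub>E I V"
    and no_isolated_vertex: "i \<in> I \<Longrightarrow> v \<in> V i \<Longrightarrow> \<exists>e\<in>E. e i = v"
    and even_card_octahedron: "x \<in> Pi\<^sub>E I V \<Longrightarrow> y \<in> Pi\<^sub>E I V \<Longrightarrow> (\<And>i. i \<in> I \<Longrightarrow> x i \<noteq> y i) \<Longrightarrow>
      even (card (E \<inter> octahedron I x y))"
begin

lemma finite_E: "finite E"
  using E_subset finite_I finite_V by (meson finite_PiE finite_subset)

definition deg :: "'i \<Rightarrow> 'a \<Rightarrow> nat" where
  "deg i v = card {e \<in> E. e i = v}"

lemma sum_deg:
  assumes "i \<in> I"
  shows "(\<Sum>v\<in>V i. deg i v) = card E"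
proof -
  have "(\<Sum>v\<in>V i. deg i v) = (\<Sum>v\<in>V i. \<Sum>e | e \<in> E \<and> e i = v. 1)"
    by (simp add: deg_def)
  also have "\<dots> = (\<Sum>e\<in>E. 1)"
    using assms E_subset by (intro sum.group finite_E finite_V) auto
  finally show ?thesis by simp
qed

lemma ex_parallel_transversals:
  assumes e: "e \<in> Pi\<^sub>E I V" and i: "i \<in> I" and v: "v \<in> V i"
  obtains g where "\<And>k. k < m - 1 \<Longrightarrow> g k \<in> Pi\<^sub>E I V" "\<And>k. k < m - 1 \<Longrightarrow> g k i = v"
    "\<And>k j. k < m - 1 \<Longrightarrow> j \<in> I - {i} \<Longrightarrow> g k j \<noteq> e j"
    "\<And>j. j \<in> I - {i} \<Longrightarrow> inj_on (\<lambda>k. g k j) {..<m - 1}"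
proof -
  have "\<exists>h. bij_betw h {..<m - 1} (V j - {e j})" if "j \<in> I" for j
    using e that card_V finite_V
    by (intro finite_same_card_bij) (auto simp: PiE_mem card_Diff_singleton)
  then obtain h where h: "\<And>j. j \<in> I \<Longrightarrow> bij_betw (h j) {..<m - 1} (V j - {e j})"
    by metis
  define g where "g k = (\<lambda>j\<in>I. h j k)(i := v)" for k
  have h_mem: "h j k \<in> V j - {e j}" if "j \<in> I" "k < m - 1" for j k
    using bij_betwE[OF h[OF that(1)]] that(2) by blast
  show thesis
  proof (rule that[of g])
    show "g k \<in> Pi\<^sub>E I V" if "k < m - 1" for k
      using h_mem[OF _ that] i v by (auto simp: g_def PiE_def extensional_def)
    show "g k i = v" for k by (simp add: g_def)
    show "g k j \<noteq> e j" if "k < m - 1" "j \<in> I - {i}" for k j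
      using h_mem[of j k] that by (simp add: g_def)
    show "inj_on (\<lambda>k. g k j) {..<m - 1}" if "j \<in> I - {i}" for j
      using bij_betw_imp_inj_on[OF h, of j] that by (simp add: g_def)
  qed
qed

lemma ex_other_edge_in_octahedron:
  assumes e: "e \<in> E" and i: "i \<in> I" and g: "g \<in> Pi\<^sub>E I V" and upd: "e(i := g i) \<notin> E"
    and disjoint: "\<And>j. j \<in> I - {i} \<Longrightarrow> g j \<noteq> e j"
  obtains f j where "f \<in> E" "f \<in> octahedron I e g" "j \<in> I - {i}" "f j = g j"
proof -
  have "e i \<noteq> g i" using e upd by (metis fun_upd_triv)
  then have "even (card (E \<inter> octahedron I e g))"
    using e E_subset g disjoint by (intro even_card_octahedron) (auto, metis)
  moreover have "e \<in> E \<inter> octahedron I e g"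
    using e E_subset by (auto simp: octahedron_def)
  ultimately have "E \<inter> octahedron I e g \<noteq> {e}" by auto
  then obtain f where f: "f \<in> E" "f \<in> octahedron I e g" "f \<noteq> e"
    using \<open>e \<in> E \<inter> octahedron I e g\<close> by blast
  have "\<exists>j\<in>I - {i}. f j = g j"
  proof (rule ccontr)
    assume "\<not> ?thesis"
    moreover have "f \<in> Pi\<^sub>E I V" "e \<in> Pi\<^sub>E I V" using f(1) e E_subset by blast+
    ultimately have "f = e(i := f i)"
      using octahedron_cases[OF f(2)] by (intro ext) (metis DiffI PiE_arb fun_upd_apply singletonD)
    then show False using f octahedron_cases[OF f(2) i] upd by (metis fun_upd_triv)
  qed
  then show thesis using that f by blast
qed

text \<open>The octahedra spanned by \<open>e\<close> and parallel transversals through \<open>v\<close> meet only in \<open>e\<close> and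
  \<open>e(i := v)\<close>, so the edges found in them by parity are distinct.\<close>

lemma le_deg_add_deg:
  assumes e: "e \<in> E" and i: "i \<in> I" and v: "v \<in> V i" and upd: "e(i := v) \<notin> E"
  shows "m \<le> deg i (e i) + deg i v"
proof -
  have eV: "e \<in> Pi\<^sub>E I V" using e E_subset by blast
  obtain g where g: "\<And>k. k < m - 1 \<Longrightarrow> g k \<in> Pi\<^sub>E I V" "\<And>k. k < m - 1 \<Longrightarrow> g k i = v"
    and g_disjoint: "\<And>k j. k < m - 1 \<Longrightarrow> j \<in> I - {i} \<Longrightarrow> g k j \<noteq> e j"
    and g_inj: "\<And>j. j \<in> I - {i} \<Longrightarrow> inj_on (\<lambda>k. g k j) {..<m - 1}"
    using ex_parallel_transversals[OF eV i v] by metis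
  have "\<exists>f j. f \<in> E \<and> f \<in> octahedron I e (g k) \<and> j \<in> I - {i} \<and> f j = g k j"
    if k: "k < m - 1" for k
    using ex_other_edge_in_octahedron[OF e i g(1)[OF k]] g(2)[OF k] g_disjoint[OF k] upd by metis
  then obtain f j where f: "\<And>k. k < m - 1 \<Longrightarrow> f k \<in> E"
      "\<And>k. k < m - 1 \<Longrightarrow> f k \<in> octahedron I e (g k)"
    and j: "\<And>k. k < m - 1 \<Longrightarrow> j k \<in> I - {i}" "\<And>k. k < m - 1 \<Longrightarrow> f k (j k) = g k (j k)"
    by metis
  have "inj_on f {..<m - 1}"
  proof (rule inj_onI)
    fix k l assume kl: "k \<in> {..<m - 1}" "l \<in> {..<m - 1}" and "f k = f l"
    then have "g k (j k) = e (j k) \<or> g k (j k) = g l (j k)"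
      using octahedron_cases[OF f(2)[of l], of "j k"] j[of k] by simp
    then have "g k (j k) = g l (j k)" using g_disjoint j(1) kl(1) by blast
    then show "k = l" using inj_onD[OF g_inj] j(1) kl by auto
  qed
  moreover have "e \<notin> f ` {..<m - 1}"
    using j g_disjoint by force
  ultimately have "Suc (m - 1) = card (insert e (f ` {..<m - 1}))"
    by (simp add: card_image)
  also have "\<dots> \<le> card ({h \<in> E. h i = e i} \<union> {h \<in> E. h i = v})"
  proof (rule card_mono)
    have "f k i = e i \<or> f k i = v" if "k < m - 1" for k
      using octahedron_cases[OF f(2)[OF that] i] g(2)[OF that] by simp
    then show "insert e (f ` {..<m - 1}) \<subseteq> {h \<in> E. h i = e i} \<union> {h \<in> E. h i = v}"
      using e f(1) by blast
  qed (use finite_E in simp)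
  also have "\<dots> \<le> deg i (e i) + deg i v"
    unfolding deg_def by (rule card_Un_le)
  finally show ?thesis by simp
qed

lemma deg_eq_of_deg_add_less:
  assumes i: "i \<in> I" and "u \<in> V i" "v \<in> V i" "deg i u + deg i v < m"
  shows "deg i u = deg i v"
proof -
  have "deg i u \<le> deg i v" if "u \<in> V i" "v \<in> V i" "deg i u + deg i v < m" for u v
    unfolding deg_def
  proof (rule card_inj_on_le)
    show "(\<lambda>e. e(i := v)) ` {e \<in> E. e i = u} \<subseteq> {e \<in> E. e i = v}"
      using le_deg_add_deg[OF _ i] that by force
    show "inj_on (\<lambda>e. e(i := v)) {e \<in> E. e i = u}"
      by (rule inj_onI) (metis (mono_tags) fun_upd_triv fun_upd_upd mem_Collect_eq)
  qed (use finite_E in simp)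
  then show ?thesis using assms by (simp add: add.commute le_antisym)
qed

definition low :: "'i \<Rightarrow> 'a set" where
  "low i = {v \<in> V i. 2 * deg i v < m}"

lemma low_subset: "low i \<subseteq> V i"
  by (auto simp: low_def)

lemma deg_eq_of_low:
  assumes "i \<in> I" "u \<in> low i" "v \<in> low i"
  shows "deg i u = deg i v"
  using assms by (intro deg_eq_of_deg_add_less) (auto simp: low_def)

lemma le_deg_add_deg_of_low:
  assumes "i \<in> I" "u \<in> low i" "v \<in> V i - low i"
  shows "m \<le> deg i u + deg i v"
  using assms deg_eq_of_deg_add_less[of i u v] by (force simp: low_def)

lemma low_high_count_le_card_E:
  assumes i: "i \<in> I" and u: "u \<in> low i"
  defines "a \<equiv> int (card (low i))" and "\<delta> \<equiv> int (deg i u)"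
  shows "a * \<delta> + (int m - a) * (int m - \<delta>) \<le> int (card E)"
proof -
  have "card (low i) \<le> m"
    using card_mono[OF finite_V[OF i] low_subset] card_V[OF i] by simp
  then have "int (card (V i - low i)) = int m - a"
    using card_Diff_subset[OF finite_subset[OF low_subset] low_subset] finite_V[OF i] card_V[OF i]
    by (simp add: a_def)
  moreover have "\<delta> \<le> int (deg i v)" if "v \<in> low i" for v
    using deg_eq_of_low[OF i u that] by (simp add: \<delta>_def)
  moreover have "int m - \<delta> \<le> int (deg i v)" if "v \<in> V i - low i" for v
    using le_deg_add_deg_of_low[OF i u that] by (simp add: \<delta>_def)
  ultimately have "a * \<delta> + (int m - a) * (int m - \<delta>)
      \<le> (\<Sum>v\<in>low i. int (deg i v)) + (\<Sum>v\<in>V i - low i. int (deg i v))"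
    using sum_bounded_below[of "low i" \<delta> "\<lambda>v. int (deg i v)"]
      sum_bounded_below[of "V i - low i" "int m - \<delta>" "\<lambda>v. int (deg i v)"]
    by (simp add: a_def)
  also have "\<dots> = int (card E)"
    using sum.subset_diff[OF low_subset finite_V[OF i], of "\<lambda>v. int (deg i v)"]
    by (simp flip: sum_deg[OF i])
  finally show ?thesis .
qed

lemma half_less_card_low:
  assumes i: "i \<in> I" and few: "2 * card E < m * m"
  shows "m < 2 * card (low i)"
proof (rule ccontr)
  assume minority: "\<not> ?thesis"
  have "low i \<noteq> {}"
  proof
    assume "low i = {}"
    then have "\<And>v. v \<in> V i \<Longrightarrow> m \<le> 2 * deg i v" by (auto simp: low_def)
    then have "m * m \<le> (\<Sum>v\<in>V i. 2 * deg i v)"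
      using sum_bounded_below[of "V i" m] card_V[OF i] by simp
    then show False using few sum_deg[OF i] by (simp flip: sum_distrib_left)
  qed
  then obtain u where u: "u \<in> low i" by blast
  define a \<delta> where "a = int (card (low i))" and "\<delta> = int (deg i u)"
  have "a * \<delta> + (int m - a) * (int m - \<delta>) \<le> int (card E)"
    using low_high_count_le_card_E[OF i u] by (simp add: a_def \<delta>_def)
  moreover have "2 * (a * \<delta> + (int m - a) * (int m - \<delta>))
      = int m * int m + (int m - 2 * a) * (int m - 2 * \<delta>)"
    by (simp add: algebra_simps)
  moreover have "0 \<le> (int m - 2 * a) * (int m - 2 * \<delta>)"
    using minority u by (intro mult_nonneg_nonneg) (auto simp: a_def \<delta>_def low_def)
  ultimately have "int (m * m) \<le> int (2 * card E)" by simp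
  then show False using few by linarith
qed

text \<open>All low vertices of colour \<open>j\<close> are interchangeable in an edge, and they form a majority, so
  an edge through two low vertices would give the other one too large a degree.\<close>

lemma edge_low_colour_unique:
  assumes few: "2 * card E < m * m" and e: "e \<in> E" and ij: "i \<in> I" "j \<in> I"
    and low: "e i \<in> low i" "e j \<in> low j"
  shows "i = j"
proof (rule ccontr)
  assume "i \<noteq> j"
  have "e(j := v) \<in> E" if "v \<in> low j" for v
    using le_deg_add_deg[OF e ij(2), of v] low(2) that by (force simp: low_def)
  then have "card (low j) \<le> deg i (e i)"
    unfolding deg_def using finite_E \<open>i \<noteq> j\<close>
    by (intro card_inj_on_le[of "\<lambda>v. e(j := v)"]) (auto intro: inj_onI dest: fun_upd_eqD)
  then show False
    using half_less_card_low[OF ij(2) few] low(1) by (simp add: low_def)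
qed

lemma sum_card_low_le:
  assumes few: "2 * card E < m * m"
  shows "(\<Sum>i\<in>I. card (low i)) \<le> card E"
proof -
  have "(\<Sum>i\<in>I. card (low i)) \<le> (\<Sum>i\<in>I. card {e \<in> E. e i \<in> low i})"
  proof (rule sum_mono)
    fix i assume "i \<in> I"
    then have "low i \<subseteq> (\<lambda>e. e i) ` {e \<in> E. e i \<in> low i}"
      using no_isolated_vertex low_subset by fast
    then show "card (low i) \<le> card {e \<in> E. e i \<in> low i}"
      using finite_E by (intro surj_card_le) auto
  qed
  also have "\<dots> = (\<Sum>e\<in>E. card {i \<in> I. e i \<in> low i})"
    by (rule sum_multicount_gen[OF finite_I finite_E]) simp
  also have "\<dots> \<le> (\<Sum>e\<in>E. 1)"
    using edge_low_colour_unique[OF few] finite_I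
    by (intro sum_mono) (auto simp: card_le_Suc0_iff_eq)
  finally show ?thesis by simp
qed

theorem card_edges_ge: "m * min m (card I) \<le> 2 * card E"
proof (cases "2 * card E < m * m")
  case True
  have "m * min m (card I) \<le> (\<Sum>i\<in>I. m)" by simp
  also have "\<dots> \<le> (\<Sum>i\<in>I. 2 * card (low i))"
    using half_less_card_low[OF _ True] by (intro sum_mono) (simp add: less_imp_le)
  also have "\<dots> \<le> 2 * card E"
    using sum_card_low_le[OF True] by (simp flip: sum_distrib_left)
  finally show ?thesis .
next
  case False
  have "m * min m (card I) \<le> m * m" by simp
  with False show ?thesis by linarith
qed

end

section \<open>Parity of the facets containing a point\<close>

definition barycentric :: "'a::real_vector set \<Rightarrow> ('a \<Rightarrow> real) \<Rightarrow> 'a \<Rightarrow> bool" where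
  "barycentric T c p \<longleftrightarrow> sum c T = 1 \<and> (\<Sum>x\<in>T. c x *\<^sub>R x) = p"

definition affine_relation :: "'a::real_vector set \<Rightarrow> ('a \<Rightarrow> real) \<Rightarrow> bool" where
  "affine_relation T m \<longleftrightarrow> sum m T = 0 \<and> (\<Sum>x\<in>T. m x *\<^sub>R x) = 0"

lemma barycentric_diff_scaled_relation:
  assumes "barycentric T c p" "affine_relation T m"
  shows "barycentric T (\<lambda>x. c x - r * m x) p"
proof -
  have "(\<Sum>x\<in>T. (r * m x) *\<^sub>R x) = r *\<^sub>R (\<Sum>x\<in>T. m x *\<^sub>R x)"
    by (simp add: scaleR_sum_right)
  then show ?thesis
    using assms unfolding barycentric_def affine_relation_def
    by (simp add: sum_subtractf scaleR_diff_left flip: sum_distrib_left)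
qed

lemma affine_relation_diff_barycentric:
  "barycentric T b p \<Longrightarrow> barycentric T c p \<Longrightarrow> affine_relation T (\<lambda>x. b x - c x)"
  unfolding barycentric_def affine_relation_def by (simp add: sum_subtractf scaleR_diff_left)

lemma barycentric_mono_neutral:
  assumes "finite T" "A \<subseteq> T" "\<And>x. x \<in> T - A \<Longrightarrow> c x = 0"
  shows "barycentric A c p \<longleftrightarrow> barycentric T c p"
proof -
  have "sum c A = sum c T" "(\<Sum>x\<in>A. c x *\<^sub>R x) = (\<Sum>x\<in>T. c x *\<^sub>R x)"
    using assms by (auto intro!: sum.mono_neutral_left)
  then show ?thesis by (simp add: barycentric_def)
qed

lemma mem_affine_hull_iff_barycentric:
  "finite T \<Longrightarrow> p \<in> affine hull T \<longleftrightarrow> (\<exists>c. barycentric T c p)"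
  by (simp add: affine_hull_finite barycentric_def)

lemma mem_convex_hull_iff_barycentric:
  "finite T \<Longrightarrow> p \<in> convex hull T \<longleftrightarrow> (\<exists>c. barycentric T c p \<and> (\<forall>x\<in>T. 0 \<le> c x))"
  by (auto simp: convex_hull_finite barycentric_def)

lemma affine_relation_vanishes:
  assumes T: "finite T" "v \<in> T" "\<not> affine_dependent (T - {v})"
    and m: "affine_relation T m" "m v = 0" and x: "x \<in> T"
  shows "m x = 0"
proof -
  have "sum m (T - {v}) = 0" "(\<Sum>x\<in>T - {v}. m x *\<^sub>R x) = 0"
    using m sum.remove[OF T(1,2), of m] sum.remove[OF T(1,2), of "\<lambda>x. m x *\<^sub>R x"]
    by (simp_all add: affine_relation_def)
  then have "\<forall>x\<in>T - {v}. m x = 0"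
    using T affine_dependent_explicit_finite[of "T - {v}"] by blast
  then show ?thesis using m(2) x by blast
qed

lemma mem_convex_hull_remove_iff_barycentric:
  assumes "finite T" "v \<in> T"
  shows "p \<in> convex hull (T - {v}) \<longleftrightarrow>
    (\<exists>c. barycentric T c p \<and> c v = 0 \<and> (\<forall>x\<in>T. 0 \<le> c x))"
proof
  assume "p \<in> convex hull (T - {v})"
  then obtain c where c: "barycentric (T - {v}) c p" "\<forall>x\<in>T - {v}. 0 \<le> c x"
    using assms(1) by (auto simp: mem_convex_hull_iff_barycentric)
  have "barycentric (T - {v}) (c(v := 0)) p"
    using c(1) by (simp add: barycentric_def)
  then have "barycentric T (c(v := 0)) p"
    using assms by (subst (asm) barycentric_mono_neutral[of T]) auto
  then show "\<exists>c. barycentric T c p \<and> c v = 0 \<and> (\<forall>x\<in>T. 0 \<le> c x)"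
    using c(2) by (intro exI[of _ "c(v := 0)"]) auto
next
  assume "\<exists>c. barycentric T c p \<and> c v = 0 \<and> (\<forall>x\<in>T. 0 \<le> c x)"
  then obtain c where c: "barycentric T c p" "c v = 0" "\<forall>x\<in>T. 0 \<le> c x" by blast
  then have "barycentric (T - {v}) c p"
    using assms by (subst barycentric_mono_neutral[of T]) auto
  then show "p \<in> convex hull (T - {v})"
    using assms(1) c(3) by (auto simp: mem_convex_hull_iff_barycentric)
qed

lemma mem_convex_hull_remove_iff:
  assumes T: "finite T" "v \<in> T" "\<not> affine_dependent (T - {v})"
    and c: "barycentric T c p" and m: "affine_relation T m" "m v \<noteq> 0"
  shows "p \<in> convex hull (T - {v}) \<longleftrightarrow> (\<forall>u\<in>T. c v / m v * m u \<le> c u)"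
proof -
  define b where "b u = c u - c v / m v * m u" for u
  have b: "barycentric T b p"
    unfolding b_def by (rule barycentric_diff_scaled_relation[OF c m(1)])
  have b_v: "b v = 0" using m(2) by (simp add: b_def)
  have unique: "a u = b u" if "barycentric T a p" "a v = 0" "u \<in> T" for a u
    using affine_relation_vanishes[OF T affine_relation_diff_barycentric[OF that(1) b]] that b_v
    by simp
  have "p \<in> convex hull (T - {v}) \<longleftrightarrow>
      (\<exists>a. barycentric T a p \<and> a v = 0 \<and> (\<forall>x\<in>T. 0 \<le> a x))"
    using T by (intro mem_convex_hull_remove_iff_barycentric)
  also have "\<dots> \<longleftrightarrow> (\<forall>u\<in>T. 0 \<le> b u)" using b b_v unique by metis
  finally show ?thesis by (simp add: b_def)
qed

lemma mem_affine_hull_remove2: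
  assumes "finite T" and c: "barycentric T c p" and m: "affine_relation T m"
    and uv: "m u \<noteq> 0" "m v \<noteq> 0" "c u / m u = c v / m v"
  shows "p \<in> affine hull (T - {u, v})"
proof -
  define b where "b x = c x - c v / m v * m x" for x
  have "b v = 0" using uv(2) by (simp add: b_def)
  moreover have "b u = 0" unfolding b_def uv(3)[symmetric] using uv(1) by simp
  moreover have "barycentric T b p"
    unfolding b_def by (rule barycentric_diff_scaled_relation[OF c m])
  ultimately have "barycentric (T - {u, v}) b p"
    using assms(1) barycentric_mono_neutral[of T "T - {u, v}" b p] by auto
  then show ?thesis using assms(1) by (auto simp: mem_affine_hull_iff_barycentric)
qed

lemma ex_nonvanishing_affine_relation:
  assumes T: "finite T" "affine_dependent T" "\<And>v. v \<in> T \<Longrightarrow> \<not> affine_dependent (T - {v})"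
  shows "\<exists>m. affine_relation T m \<and> (\<forall>v\<in>T. m v \<noteq> 0)"
proof -
  obtain m where m: "affine_relation T m" "\<exists>x\<in>T. m x \<noteq> 0"
    using T by (auto simp: affine_dependent_explicit_finite affine_relation_def)
  then show ?thesis using affine_relation_vanishes[OF T(1) _ T(3) m(1)] by blast
qed

lemma even_card_separating:
  fixes L U :: "'a::linorder set"
  assumes fin: "finite L" "finite U" and ne: "L \<noteq> {}" "U \<noteq> {}" and disj: "L \<inter> U = {}"
  shows "even (card {v \<in> L \<union> U. (\<forall>u\<in>L. u \<le> v) \<and> (\<forall>u\<in>U. v \<le> u)})"
    (is "even (card ?F)")
proof (cases "?F = {}")
  case True
  then show ?thesis by (simp only: card.empty even_zero)
next
  case False
  then obtain v where v: "\<forall>u\<in>L. u \<le> v" "\<forall>u\<in>U. v \<le> u" by blast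
  obtain a where a: "a \<in> L" "\<And>u. u \<in> L \<Longrightarrow> u \<le> a"
    using fin(1) ne(1) by (meson Max_in Max_ge)
  obtain b where b: "b \<in> U" "\<And>u. u \<in> U \<Longrightarrow> b \<le> u"
    using fin(2) ne(2) by (meson Min_in Min_le)
  have "a \<le> b" using v a(1) b(1) order_trans by blast
  have "?F = {a, b}"
  proof
    show "?F \<subseteq> {a, b}"
    proof
      fix w assume w: "w \<in> ?F"
      then have "a \<le> w" "w \<le> b" using a(1) b(1) by simp_all
      then show "w \<in> {a, b}" using w a(2)[of w] b(2)[of w] by auto
    qed
    show "{a, b} \<subseteq> ?F"
      using a b \<open>a \<le> b\<close> by (auto intro: order_trans)
  qed
  moreover have "a \<noteq> b" using a(1) b(1) disj by blast
  ultimately show ?thesis by simp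
qed

lemma even_card_separating_values:
  fixes r :: "'b \<Rightarrow> 'a::linorder"
  assumes "finite L" "finite U" "L \<noteq> {}" "U \<noteq> {}" "L \<inter> U = {}"
    and inj: "inj_on r (L \<union> U)"
  shows "even (card {v \<in> L \<union> U. (\<forall>u\<in>L. r u \<le> r v) \<and> (\<forall>u\<in>U. r v \<le> r u)})"
    (is "even (card ?F)")
proof -
  have "card ?F = card (r ` ?F)"
    using inj by (intro card_image[symmetric]) (auto simp: inj_on_def)
  also have "r ` ?F = {v \<in> r ` L \<union> r ` U. (\<forall>u\<in>r ` L. u \<le> v) \<and> (\<forall>u\<in>r ` U. v \<le> u)}"
    by blast
  also have "even (card \<dots>)"
    using assms by (intro even_card_separating) (auto simp: inj_on_image_Int[symmetric])
  finally show ?thesis .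
qed

lemma affine_relation_ex_pos:
  assumes "finite T" "T \<noteq> {}" and m: "affine_relation T m" "\<And>x. x \<in> T \<Longrightarrow> m x \<noteq> 0"
  shows "\<exists>x\<in>T. 0 < m x"
proof (rule ccontr)
  assume "\<not> ?thesis"
  then have "\<And>x. x \<in> T \<Longrightarrow> 0 < - m x" using m(2) by (force simp: not_less less_le)
  then have "0 < (\<Sum>x\<in>T. - m x)" using assms(1,2) by (intro sum_pos)
  then show False using m(1) by (simp add: affine_relation_def sum_negf)
qed

lemma affine_relation_uminus: "affine_relation T m \<Longrightarrow> affine_relation T (\<lambda>x. - m x)"
  by (simp add: affine_relation_def sum_negf)

text \<open>The barycentric coordinates of \<open>p\<close> that vanish at \<open>v\<close> are \<open>c - (c v / m v) m\<close>, so the facet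
  opposite \<open>v\<close> contains \<open>p\<close> iff \<open>c v / m v\<close> separates the ratios of the points with \<open>m < 0\<close> from
  those of the points with \<open>m > 0\<close>.\<close>

theorem even_card_facets_containing:
  assumes T: "finite T" "affine_dependent T" "\<And>v. v \<in> T \<Longrightarrow> \<not> affine_dependent (T - {v})"
    and p: "p \<in> affine hull T"
    and generic: "\<And>u v. u \<in> T \<Longrightarrow> v \<in> T \<Longrightarrow> u \<noteq> v \<Longrightarrow> p \<notin> affine hull (T - {u, v})"
  shows "even (card {v \<in> T. p \<in> convex hull (T - {v})})"
proof -
  obtain m where m: "affine_relation T m" "\<And>v. v \<in> T \<Longrightarrow> m v \<noteq> 0"
    using ex_nonvanishing_affine_relation[OF T] by blast
  obtain c where c: "barycentric T c p"
    using p T(1) by (auto simp: mem_affine_hull_iff_barycentric)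
  define r where "r v = c v / m v" for v
  have inj_r: "inj_on r T"
    using mem_affine_hull_remove2[OF T(1) c m(1)] m(2) generic unfolding r_def
    by (meson inj_onI)
  define N P where "N = {u \<in> T. m u < 0}" and "P = {u \<in> T. 0 < m u}"
  have T_eq: "N \<union> P = T" using m(2) by (auto simp: N_def P_def neq_iff)
  have "p \<in> convex hull (T - {v}) \<longleftrightarrow> (\<forall>u\<in>N. r u \<le> r v) \<and> (\<forall>u\<in>P. r v \<le> r u)"
    if v: "v \<in> T" for v
  proof -
    have "p \<in> convex hull (T - {v}) \<longleftrightarrow> (\<forall>u\<in>N \<union> P. r v * m u \<le> c u)"
      using mem_convex_hull_remove_iff[OF T(1) v T(3) c m] v by (simp add: r_def T_eq)
    also have "\<dots> \<longleftrightarrow> (\<forall>u\<in>N. r u \<le> r v) \<and> (\<forall>u\<in>P. r v \<le> r u)"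
      unfolding ball_Un by (simp add: N_def P_def r_def divide_le_eq le_divide_eq)
    finally show ?thesis .
  qed
  then have "{v \<in> T. p \<in> convex hull (T - {v})}
      = {v \<in> N \<union> P. (\<forall>u\<in>N. r u \<le> r v) \<and> (\<forall>u\<in>P. r v \<le> r u)}"
    unfolding T_eq by blast
  also have "even (card \<dots>)"
  proof (rule even_card_separating_values)
    have "T \<noteq> {}" using T(2) by auto
    then show "P \<noteq> {}" "N \<noteq> {}"
      using affine_relation_ex_pos[OF T(1) _ m]
        affine_relation_ex_pos[OF T(1) _ affine_relation_uminus[OF m(1)]] m(2)
      by (auto simp: N_def P_def)
    show "inj_on r (N \<union> P)" using inj_r by (simp add: T_eq)
  qed (use T(1) in \<open>auto simp: N_def P_def\<close>)
  finally show ?thesis .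
qed

lemma general_position_subset:
  "general_position P \<Longrightarrow> Q \<subseteq> P \<Longrightarrow> general_position Q"
  unfolding general_position_def by blast

lemma general_position_not_affine_dependent:
  fixes P :: "(real^'n) set"
  shows "general_position P \<Longrightarrow> A \<subseteq> P \<Longrightarrow> card A \<le> CARD('n) + 1 \<Longrightarrow> \<not> affine_dependent A"
  unfolding general_position_def by blast

lemma general_position_not_mem_affine_hull:
  fixes A :: "(real^'n) set"
  assumes "general_position (insert p A)" "p \<notin> A" "finite A" "card A \<le> CARD('n)"
  shows "p \<notin> affine hull A"
proof
  assume "p \<in> affine hull A"
  then have "affine_dependent (insert p A)"
    using assms(2) unfolding affine_dependent_def by (auto intro!: bexI[of _ p])
  then show False
    using assms general_position_not_affine_dependent[of "insert p A" "insert p A"] by simp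
qed

lemma general_position_even_card_facets_containing:
  fixes T :: "(real^'n) set"
  assumes T: "finite T" "card T = CARD('n) + 2" "p \<notin> T" and gp: "general_position (insert p T)"
  shows "even (card {v \<in> T. p \<in> convex hull (T - {v})})"
proof (rule even_card_facets_containing[OF T(1)])
  show "affine_dependent T"
    using T by (intro affine_dependent_biggerset) auto
  show indep: "\<not> affine_dependent (T - {v})" if "v \<in> T" for v
    using general_position_not_affine_dependent[OF gp, of "T - {v}"] T that by auto
  show "p \<in> affine hull T"
  proof -
    obtain v where "v \<in> T" using T(2) by fastforce
    then have "affine hull (T - {v}) = UNIV"
      using indep T by (intro affine_independent_span_eq) auto
    then show ?thesis using hull_mono[of "T - {v}" T] by blast
  qed
  show "p \<notin> affine hull (T - {u, v})" if "u \<in> T" "v \<in> T" "u \<noteq> v" for u v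
  proof (rule general_position_not_mem_affine_hull)
    show "general_position (insert p (T - {u, v}))"
      using gp by (rule general_position_subset) blast
  qed (use T that in \<open>auto simp: card_Diff_subset\<close>)
qed

section \<open>The colourful Caratheodory theorem\<close>

lemma sum_in_convex_cone_hull:
  assumes "\<And>u. u \<in> A \<Longrightarrow> f u \<in> convex_cone hull S"
  shows "sum f A \<in> convex_cone hull S"
  using assms
  by (induction A rule: infinite_finite_induct)
    (auto intro: convex_cone_hull_add convex_cone_hull_contains_0)

lemma convex_cone_hull_finite:
  fixes U :: "'a::real_vector set"
  assumes "finite U"
  shows "convex_cone hull U = {y. \<exists>c. (\<forall>u\<in>U. 0 \<le> c u) \<and> (\<Sum>u\<in>U. c u *\<^sub>R u) = y}"
    (is "_ = ?C")
proof
  show "convex_cone hull U \<subseteq> ?C"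
  proof (rule hull_minimal)
    show "U \<subseteq> ?C"
    proof
      fix v assume "v \<in> U"
      then have "(\<Sum>u\<in>U. of_bool (u = v) *\<^sub>R u) = v"
        using assms by (subst sum.remove) auto
      then show "v \<in> ?C" by (force intro: exI[of _ "\<lambda>u. of_bool (u = v)"])
    qed
    show "convex_cone ?C"
      unfolding convex_cone_iff
    proof (intro conjI ballI allI impI)
      show "0 \<in> ?C" by (auto intro: exI[of _ "\<lambda>_. 0"])
    next
      fix x y assume "x \<in> ?C" "y \<in> ?C"
      then obtain b c where "\<forall>u\<in>U. 0 \<le> b u" "x = (\<Sum>u\<in>U. b u *\<^sub>R u)"
        "\<forall>u\<in>U. 0 \<le> c u" "y = (\<Sum>u\<in>U. c u *\<^sub>R u)" by blast
      then show "x + y \<in> ?C"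
        by (auto simp: scaleR_add_left sum.distrib intro!: exI[of _ "\<lambda>u. b u + c u"])
    next
      fix x :: 'a and r :: real assume "x \<in> ?C" "0 \<le> r"
      then obtain c where "\<forall>u\<in>U. 0 \<le> c u" "x = (\<Sum>u\<in>U. c u *\<^sub>R u)" by blast
      then show "r *\<^sub>R x \<in> ?C"
        using \<open>0 \<le> r\<close> by (auto simp: scaleR_sum_right intro!: exI[of _ "\<lambda>u. r * c u"])
    qed
  qed
  show "?C \<subseteq> convex_cone hull U"
    by (auto intro: sum_in_convex_cone_hull convex_cone_hull_mul hull_inc)
qed

lemma ex_linear_relation_pos:
  fixes U :: "'a::real_vector set"
  assumes "finite U" "dependent U"
  shows "\<exists>b. (\<Sum>u\<in>U. b u *\<^sub>R u) = 0 \<and> (\<exists>u\<in>U. 0 < b u)"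
proof -
  obtain b w where b: "(\<Sum>u\<in>U. b u *\<^sub>R u) = 0" "w \<in> U" "b w \<noteq> 0"
    using assms by (auto simp: dependent_finite)
  show ?thesis
  proof (cases "0 < b w")
    case True
    then show ?thesis using b by blast
  next
    case False
    then have "0 < - b w" using b(3) by simp
    moreover have "(\<Sum>u\<in>U. - b u *\<^sub>R u) = 0" using b(1) by (simp add: sum_negf)
    ultimately show ?thesis using b(2) by (intro exI[of _ "\<lambda>u. - b u"] conjI bexI[of _ w])
  qed
qed

lemma convex_cone_hull_remove_dependent:
  fixes U :: "'a::real_vector set"
  assumes fin: "finite U" and dep: "dependent U" and z: "z \<in> convex_cone hull U"
  shows "\<exists>v\<in>U. z \<in> convex_cone hull (U - {v})"
proof -
  obtain c where c: "\<forall>u\<in>U. 0 \<le> c u" "(\<Sum>u\<in>U. c u *\<^sub>R u) = z"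
    using z fin by (auto simp: convex_cone_hull_finite)
  obtain b where b: "(\<Sum>u\<in>U. b u *\<^sub>R u) = 0" "\<exists>u\<in>U. 0 < b u"
    using ex_linear_relation_pos[OF fin dep] by blast
  obtain v where v: "v \<in> U" "0 < b v"
    and v_min: "\<And>u. u \<in> U \<Longrightarrow> 0 < b u \<Longrightarrow> c v / b v \<le> c u / b u"
    using ex_min_if_finite[of "(\<lambda>u. c u / b u) ` {u \<in> U. 0 < b u}"] fin b(2)
    by (force simp: not_less)
  define c' where "c' u = c u - c v / b v * b u" for u
  have "0 \<le> c' u" if u: "u \<in> U" for u
  proof (cases "0 < b u")
    case True
    then show ?thesis using v_min[OF u] by (simp add: c'_def field_simps)
  next
    case False
    then have "c v / b v * b u \<le> 0" using c(1) v by (intro mult_nonneg_nonpos) auto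
    then show ?thesis using bspec[OF c(1) u] unfolding c'_def by linarith
  qed
  moreover have "(\<Sum>u\<in>U - {v}. c' u *\<^sub>R u) = z"
  proof -
    have "c' v = 0" using v by (simp add: c'_def)
    then have "(\<Sum>u\<in>U - {v}. c' u *\<^sub>R u) = (\<Sum>u\<in>U. c' u *\<^sub>R u)"
      using fin v(1) by (simp add: sum.remove)
    also have "\<dots> = z - (c v / b v) *\<^sub>R (\<Sum>u\<in>U. b u *\<^sub>R u)"
      by (simp add: c'_def scaleR_diff_left sum_subtractf scaleR_sum_right flip: c(2))
    finally show ?thesis by (simp add: b(1))
  qed
  ultimately have "z \<in> convex_cone hull (U - {v})"
    unfolding convex_cone_hull_finite[OF finite_Diff[OF fin]] by blast
  then show ?thesis using v(1) by blast
qed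

lemma convex_cone_hull_caratheodory:
  fixes U :: "'a::real_vector set"
  assumes "finite U" "z \<in> convex_cone hull U"
  shows "\<exists>W\<subseteq>U. independent W \<and> z \<in> convex_cone hull W"
  using assms
proof (induction U rule: finite_psubset_induct)
  case (psubset U)
  show ?case
  proof (cases "independent U")
    case True
    then show ?thesis using psubset.prems by blast
  next
    case False
    then obtain v where v: "v \<in> U" "z \<in> convex_cone hull (U - {v})"
      using convex_cone_hull_remove_dependent[OF psubset.hyps _ psubset.prems] by blast
    then obtain W where "W \<subseteq> U - {v}" "independent W" "z \<in> convex_cone hull W"
      using psubset.IH[of "U - {v}"] by blast
    then show ?thesis by blast
  qed
qed

lemma convex_cone_hull_supporting_face:
  assumes fin: "finite U" and z: "z \<in> convex_cone hull U"
    and nonneg: "\<And>u. u \<in> U \<Longrightarrow> 0 \<le> b \<bullet> u" and eq: "b \<bullet> z = 0"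
  shows "z \<in> convex_cone hull {u \<in> U. b \<bullet> u = 0}"
proof -
  obtain c where c: "\<forall>u\<in>U. 0 \<le> c u" and z_eq: "z = (\<Sum>u\<in>U. c u *\<^sub>R u)"
    using z fin by (auto simp: convex_cone_hull_finite)
  have "(\<Sum>u\<in>U. c u * (b \<bullet> u)) = 0"
    using eq by (simp add: z_eq inner_sum_right)
  then have "c u * (b \<bullet> u) = 0" if "u \<in> U" for u
    using sum_nonneg_eq_0_iff[OF fin, of "\<lambda>u. c u * (b \<bullet> u)"] c nonneg that by simp
  then have "c u *\<^sub>R u \<in> convex_cone hull {u \<in> U. b \<bullet> u = 0}" if "u \<in> U" for u
    using that c by (cases "c u = 0")
      (auto intro: convex_cone_hull_contains_0 convex_cone_hull_mul hull_inc)
  then show ?thesis unfolding z_eq by (rule sum_in_convex_cone_hull)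
qed

lemma closest_point_convex_cone:
  fixes C :: "'a::euclidean_space set"
  assumes C: "convex_cone C" "closed C"
  shows "(closest_point C a - a) \<bullet> closest_point C a = 0"
    and "u \<in> C \<Longrightarrow> 0 \<le> (closest_point C a - a) \<bullet> u"
proof -
  let ?z = "closest_point C a"
  have z: "?z \<in> C"
    using C by (simp add: closest_point_in_set convex_cone_nonempty)
  have dot: "0 \<le> (?z - a) \<bullet> (w - ?z)" if "w \<in> C" for w
    using that C closest_point_dot[of C w a] by (simp add: convex_cone_def inner_diff_left)
  show "(?z - a) \<bullet> ?z = 0"
    using dot[OF convex_cone_contains_0[OF C(1)]] dot[OF convex_cone_add[OF C(1) z z]] by simp
  show "0 \<le> (?z - a) \<bullet> u" if "u \<in> C"
    using dot[OF convex_cone_add[OF C(1) z that]] by simp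
qed

lemma convex_cone_hull_transversal_omit_colour:
  fixes t :: "'i \<Rightarrow> 'a::euclidean_space"
  assumes J: "finite J" "DIM('a) \<le> card J" and z: "z \<in> convex_cone hull (t ` J)"
    and b: "b \<noteq> 0" "b \<bullet> z = 0" "\<And>j. j \<in> J \<Longrightarrow> 0 \<le> b \<bullet> t j"
  shows "\<exists>j\<in>J. z \<in> convex_cone hull (t ` (J - {j}))"
proof -
  have "z \<in> convex_cone hull {u \<in> t ` J. b \<bullet> u = 0}"
    using J(1) z b by (intro convex_cone_hull_supporting_face) auto
  then obtain W where W: "W \<subseteq> {u \<in> t ` J. b \<bullet> u = 0}" "independent W" "z \<in> convex_cone hull W"
    using convex_cone_hull_caratheodory[of "{u \<in> t ` J. b \<bullet> u = 0}"] J(1) by auto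
  obtain K where K: "K \<subseteq> J" "inj_on t K" "W = t ` K"
    using W(1) subset_image_inj[of W t J] by blast
  have "card W \<le> dim {u. b \<bullet> u = 0}"
    using W by (intro independent_card_le_dim) auto
  also have "dim {u. b \<bullet> u = 0} < DIM('a)"
    using b(1) by (simp add: dim_hyperplane)
  finally have "card K < card J"
    using J(2) K by (simp add: card_image)
  then obtain j where "j \<in> J" "j \<notin> K" using K(1) by (metis less_irrefl subsetI subset_antisym)
  then have "W \<subseteq> t ` (J - {j})" using K by blast
  then show ?thesis using W(3) hull_mono \<open>j \<in> J\<close> by blast
qed

text \<open>Barany's exchange: the point \<open>z\<close> of the cone closest to \<open>a\<close> lies in a face that omits some
  colour \<open>j\<close>, and as \<open>a\<close> is in the cone over \<open>S j\<close>, some \<open>y \<in> S j\<close> lies on the side of \<open>a\<close> of the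
  supporting hyperplane at \<open>z\<close>.\<close>

lemma ex_closer_transversal_cone:
  fixes S :: "'i \<Rightarrow> 'a::euclidean_space set" and t :: "'i \<Rightarrow> 'a"
  assumes J: "finite J" "DIM('a) \<le> card J" and a: "\<And>j. j \<in> J \<Longrightarrow> a \<in> convex_cone hull (S j)"
  defines "K \<equiv> \<lambda>t. convex_cone hull (t ` J)"
  assumes far: "a \<notin> K t"
  obtains j y where "j \<in> J" "y \<in> S j"
    "dist a (closest_point (K (t(j := y))) a) < dist a (closest_point (K t) a)"
proof -
  have K: "convex_cone (K t)" "closed (K t)" for t
    using J(1) by (simp_all add: K_def convex_cone_convex_cone_hull closed_convex_cone_hull)
  define z where "z = closest_point (K t) a"
  define b where "b = z - a"
  have z: "z \<in> K t" using K by (simp add: z_def closest_point_in_set convex_cone_nonempty)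
  then have "b \<noteq> 0" using far by (auto simp: b_def)
  have perp: "b \<bullet> z = 0" and "\<And>u. u \<in> K t \<Longrightarrow> 0 \<le> b \<bullet> u"
    using closest_point_convex_cone[OF K] by (simp_all add: z_def b_def)
  then have "\<And>j. j \<in> J \<Longrightarrow> 0 \<le> b \<bullet> t j" by (simp add: K_def hull_inc)
  then obtain j where j: "j \<in> J" "z \<in> convex_cone hull (t ` (J - {j}))"
    using convex_cone_hull_transversal_omit_colour[OF J] z \<open>b \<noteq> 0\<close> perp unfolding K_def by blast
  have "b \<bullet> a = - (b \<bullet> b)" using perp by (simp add: b_def inner_diff_right)
  then have "b \<bullet> a < 0" using \<open>b \<noteq> 0\<close> by simp
  then have "\<not> convex_cone hull (S j) \<subseteq> {x. 0 \<le> b \<bullet> x}" using a[OF j(1)] by auto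
  then have "\<not> S j \<subseteq> {x. 0 \<le> b \<bullet> x}"
    using hull_minimal[where S = convex_cone, OF _ convex_cone_halfspace_ge] by blast
  then obtain y where y: "y \<in> S j" "b \<bullet> y < 0" using not_le by blast
  have "t ` (J - {j}) \<subseteq> (t(j := y)) ` J" by auto
  then have z': "z \<in> K (t(j := y))" using j(2) hull_mono unfolding K_def by blast
  have "y \<in> K (t(j := y))" using j(1) by (auto simp: K_def intro: hull_inc)
  then have "0 \<le> (closest_point (K (t(j := y))) a - a) \<bullet> y"
    by (rule closest_point_convex_cone(2)[OF K])
  then have "z \<noteq> closest_point (K (t(j := y))) a"
    using y(2) by (auto simp: b_def)
  then have "dist a (closest_point (K (t(j := y))) a) < dist a z"
    using K z' by (intro closest_point_lt) (auto simp: convex_cone_def)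
  then show thesis using that j(1) y(1) unfolding z_def by blast
qed

theorem colourful_caratheodory_cone:
  fixes S :: "'i \<Rightarrow> 'a::euclidean_space set"
  assumes J: "finite J" "DIM('a) \<le> card J"
    and S: "\<And>j. j \<in> J \<Longrightarrow> finite (S j)" "\<And>j. j \<in> J \<Longrightarrow> S j \<noteq> {}"
    and a: "\<And>j. j \<in> J \<Longrightarrow> a \<in> convex_cone hull (S j)"
  shows "\<exists>t\<in>Pi\<^sub>E J S. a \<in> convex_cone hull (t ` J)"
proof -
  define \<delta> where "\<delta> t = dist a (closest_point (convex_cone hull (t ` J)) a)" for t
  have "finite (Pi\<^sub>E J S)" "Pi\<^sub>E J S \<noteq> {}"
    using J S by (auto simp: PiE_eq_empty_iff intro: finite_PiE)
  then obtain t where t: "t \<in> Pi\<^sub>E J S" and t_min: "\<And>s. s \<in> Pi\<^sub>E J S \<Longrightarrow> \<delta> t \<le> \<delta> s"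
    using ex_is_arg_min_if_finite[of "Pi\<^sub>E J S" \<delta>] by (auto simp: is_arg_min_linorder)
  have "a \<in> convex_cone hull (t ` J)"
  proof (rule ccontr)
    assume "a \<notin> convex_cone hull (t ` J)"
    then obtain j y where "j \<in> J" "y \<in> S j" "\<delta> (t(j := y)) < \<delta> t"
      unfolding \<delta>_def using ex_closer_transversal_cone[where S = S and t = t] J a by blast
    moreover from this have "t(j := y) \<in> Pi\<^sub>E J S"
      using t by (auto simp: PiE_def extensional_def)
    ultimately show False using t_min by force
  qed
  then show ?thesis using t by blast
qed

lemma convex_cone_hull_eq_UNIV:
  fixes U :: "'a::real_normed_vector set"
  assumes "0 \<in> interior (convex hull U)"
  shows "convex_cone hull U = UNIV"
proof -
  obtain r where r: "0 < r" "cball 0 r \<subseteq> convex_cone hull U"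
    using assms convex_hull_subset_convex_cone_hull[of U] by (auto simp: mem_interior_cball)
  have "x \<in> convex_cone hull U" for x
  proof (cases "x = 0")
    case True
    then show ?thesis by (simp add: convex_cone_hull_contains_0)
  next
    case False
    have "(r / norm x) *\<^sub>R x \<in> cball 0 r"
      using r(1) False by simp
    then have "(norm x / r) *\<^sub>R (r / norm x) *\<^sub>R x \<in> convex_cone hull U"
      using r by (intro convex_cone_hull_mul[OF subsetD[OF r(2)]]) auto
    then show ?thesis using r(1) False by simp
  qed
  then show ?thesis by blast
qed

lemma mem_convex_hull_insert_if_convex_cone_hull:
  fixes p v :: "'a::real_vector"
  assumes "p - v \<in> convex_cone hull ((\<lambda>u. u - p) ` U)"
  shows "p \<in> convex hull (insert v U)"
proof (cases "p = v")
  case True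
  then show ?thesis by (simp add: hull_inc)
next
  case False
  then obtain c w where c: "0 \<le> c" and w: "w \<in> convex hull ((\<lambda>u. u - p) ` U)"
    and eq: "p - v = c *\<^sub>R w"
    using assms by (auto simp: convex_cone_hull_convex_hull)
  have "p + w \<in> convex hull U"
    using w convex_hull_translation[of p "(\<lambda>u. u - p) ` U"] by (auto simp: image_image)
  then have pw: "p + w \<in> convex hull (insert v U)"
    using hull_mono[of U "insert v U"] by blast
  have "(1 + c) *\<^sub>R p = v + c *\<^sub>R (p + w)"
    using eq by (simp add: algebra_simps)
  then have "(1 / (1 + c)) *\<^sub>R v + (c / (1 + c)) *\<^sub>R (p + w) = (1 / (1 + c)) *\<^sub>R (1 + c) *\<^sub>R p"
    by (simp add: scaleR_add_right)
  also have "\<dots> = p" using c by simp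
  finally show ?thesis
    using c convexD[OF convex_convex_hull hull_inc pw, of v "1 / (1 + c)" "c / (1 + c)"]
    by (simp flip: add_divide_distrib)
qed

theorem ex_colourful_simplex_at_vertex:
  fixes S :: "'i \<Rightarrow> 'a::euclidean_space set"
  assumes I: "finite I" "DIM('a) < card I" and i: "i \<in> I" and v: "v \<in> S i"
    and S: "\<And>j. j \<in> I - {i} \<Longrightarrow> finite (S j)"
      "\<And>j. j \<in> I - {i} \<Longrightarrow> p \<in> interior (convex hull (S j))"
  shows "\<exists>e\<in>Pi\<^sub>E I S. e i = v \<and> p \<in> convex hull (e ` I)"
proof -
  define S' where "S' j = (\<lambda>x. x - p) ` S j" for j
  have cone_S': "convex_cone hull (S' j) = UNIV" if "j \<in> I - {i}" for j
  proof (rule convex_cone_hull_eq_UNIV)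
    have "S' j = (+) (- p) ` S j" by (simp add: S'_def)
    then show "0 \<in> interior (convex hull (S' j))"
      using S(2)[OF that] by (simp only: convex_hull_translation interior_translation) force
  qed
  have "\<exists>t\<in>Pi\<^sub>E (I - {i}) S'. p - v \<in> convex_cone hull (t ` (I - {i}))"
  proof (rule colourful_caratheodory_cone)
    fix j assume j: "j \<in> I - {i}"
    show "finite (S' j)" using S(1)[OF j] by (simp add: S'_def)
    show "S' j \<noteq> {}" using S(2)[OF j] by (auto simp: S'_def)
  qed (use I i cone_S' in auto)
  then obtain t where t: "t \<in> Pi\<^sub>E (I - {i}) S'" "p - v \<in> convex_cone hull (t ` (I - {i}))"
    by blast
  define e where "e = (\<lambda>j\<in>I. p + t j)(i := v)"
  have "e \<in> Pi\<^sub>E I S"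
    using t(1) i v by (force simp: e_def S'_def PiE_iff extensional_def)
  moreover have "e i = v" by (simp add: e_def)
  moreover have "p \<in> convex hull (e ` I)"
  proof -
    have "(\<lambda>u. u - p) ` e ` (I - {i}) = t ` (I - {i})"
      by (auto simp: e_def image_image)
    then have "p \<in> convex hull (insert (e i) (e ` (I - {i})))"
      using t(2) \<open>e i = v\<close> by (simp add: mem_convex_hull_insert_if_convex_cone_hull)
    then show ?thesis using i by (simp add: insert_absorb flip: image_insert)
  qed
  ultimately show ?thesis by blast
qed

section \<open>Colourful simplices form an octahedral system\<close>

lemma card_PiE_update:
  assumes "i \<in> I" "a \<in> V i" "b \<in> V i"
  shows "card {f \<in> Pi\<^sub>E I V. f i = a \<and> P (f(i := b))} = card {f \<in> Pi\<^sub>E I V. f i = b \<and> P f}"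
proof (rule bij_betw_same_card, rule bij_betw_byWitness[where f' = "\<lambda>f. f(i := a)"])
  show "(\<lambda>f. f(i := b)) ` {f \<in> Pi\<^sub>E I V. f i = a \<and> P (f(i := b))}
      \<subseteq> {f \<in> Pi\<^sub>E I V. f i = b \<and> P f}"
    using assms by (auto simp: PiE_def extensional_def)
  show "(\<lambda>f. f(i := a)) ` {f \<in> Pi\<^sub>E I V. f i = b \<and> P f}
      \<subseteq> {f \<in> Pi\<^sub>E I V. f i = a \<and> P (f(i := b))}"
    using assms by (auto simp: PiE_def extensional_def)
qed auto

lemma card_octahedron_update:
  "i \<in> I \<Longrightarrow> card {f \<in> octahedron I x y. f i = x i \<and> P (f(i := y i))}
    = card {f \<in> octahedron I x y. f i = y i \<and> P f}"
  unfolding octahedron_def by (rule card_PiE_update) auto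

lemma card_octahedron_split:
  assumes "finite I" "i \<in> I" "x i \<noteq> y i"
  shows "card {f \<in> octahedron I x y. P f}
    = card {f \<in> octahedron I x y. f i = x i \<and> P f} + card {f \<in> octahedron I x y. f i = y i \<and> P f}"
proof -
  have cases: "f i = x i \<or> f i = y i" if "f \<in> octahedron I x y" for f
    using octahedron_cases[OF that assms(2)] .
  have "card {f \<in> octahedron I x y. P f}
    = card ({f \<in> octahedron I x y. f i = x i \<and> P f} \<union> {f \<in> octahedron I x y. f i = y i \<and> P f})"
    by (rule arg_cong[where f = card]) (auto dest: cases)
  also have "\<dots>
      = card {f \<in> octahedron I x y. f i = x i \<and> P f} + card {f \<in> octahedron I x y. f i = y i \<and> P f}"
    using finite_octahedron[OF assms(1), of x y] assms(3) by (intro card_Un_disjoint) auto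
  finally show ?thesis .
qed

lemma even_card_octahedron_invariant:
  assumes "finite I" "i \<in> I" "x i \<noteq> y i" and P: "\<And>f. P (f(i := y i)) \<longleftrightarrow> P f"
  shows "even (card {f \<in> octahedron I x y. P f})"
proof -
  have "card {f \<in> octahedron I x y. f i = x i \<and> P f} = card {f \<in> octahedron I x y. f i = y i \<and> P f}"
    using card_octahedron_update[of i I x y P] assms(2) by (simp add: P)
  then show ?thesis using card_octahedron_split[of I i x y P] assms(1-3) by simp
qed

lemma inj_on_PiE_disjoint_family:
  assumes "f \<in> Pi\<^sub>E I V" "disjoint_family_on V I"
  shows "inj_on f I"
proof (rule inj_onI)
  fix i j assume ij: "i \<in> I" "j \<in> I" "f i = f j"
  then have "f i \<in> V i" "f i \<in> V j"
    using PiE_mem[OF assms(1), of i] PiE_mem[OF assms(1), of j] by simp_all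
  then show "i = j" using disjoint_family_onD[OF assms(2) ij(1,2)] by blast
qed

lemma even_card_vertex_replacements_containing:
  fixes f :: "'i \<Rightarrow> real^'n"
  assumes I: "finite I" "card I = CARD('n) + 1" and f: "inj_on f I" and w: "w \<notin> f ` I"
    and p: "p \<notin> insert w (f ` I)" and gp: "general_position (insert p (insert w (f ` I)))"
  shows "even (of_bool (p \<in> convex hull (f ` I)) + card {i \<in> I. p \<in> convex hull (f(i := w) ` I)})"
proof -
  define T where "T = insert w (f ` I)"
  have "finite T" "card T = CARD('n) + 2"
    using I w by (simp_all add: T_def card_image[OF f])
  then have "even (card {v \<in> T. p \<in> convex hull (T - {v})})"
    using p gp by (intro general_position_even_card_facets_containing) (simp_all add: T_def)
  also have "{v \<in> T. p \<in> convex hull (T - {v})}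
      = {v \<in> {w}. p \<in> convex hull (f ` I)} \<union> f ` {i \<in> I. p \<in> convex hull (f(i := w) ` I)}"
  proof -
    have "T - {w} = f ` I" using w by (auto simp: T_def)
    moreover have "T - {f i} = f(i := w) ` I" if "i \<in> I" for i
      using f w that by (auto simp: T_def inj_on_def)
    ultimately show ?thesis by (auto simp: T_def)
  qed
  also have "card \<dots> = card {v \<in> {w}. p \<in> convex hull (f ` I)}
      + card (f ` {i \<in> I. p \<in> convex hull (f(i := w) ` I)})"
    using I(1) w by (intro card_Un_disjoint) auto
  also have "card (f ` {i \<in> I. p \<in> convex hull (f(i := w) ` I)})
      = card {i \<in> I. p \<in> convex hull (f(i := w) ` I)}"
    using f by (intro card_image) (auto simp: inj_on_def)
  also have "card {v \<in> {w}. p \<in> convex hull (f ` I)} = of_bool (p \<in> convex hull (f ` I))"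
    by simp
  finally show ?thesis .
qed

lemma even_card_vertex_replacements_in_octahedron:
  fixes x y :: "'i \<Rightarrow> real^'n"
  assumes I: "finite I" "card I = CARD('n) + 1"
    and disj: "disjoint_family_on (\<lambda>i. {x i, y i}) I"
    and p: "p \<notin> (\<Union>i\<in>I. {x i, y i})" and gp: "general_position (insert p (\<Union>i\<in>I. {x i, y i}))"
    and f: "f \<in> octahedron I x y" and i: "i \<in> I" "f i \<noteq> y i"
  shows "even (of_bool (p \<in> convex hull (f ` I)) + card {j \<in> I. p \<in> convex hull (f(j := y i) ` I)})"
proof (rule even_card_vertex_replacements_containing[OF I])
  have f_PiE: "f \<in> Pi\<^sub>E I (\<lambda>i. {x i, y i})" using f by (simp add: octahedron_def)
  then show "inj_on f I" using disj by (rule inj_on_PiE_disjoint_family)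
  have subset: "insert (y i) (f ` I) \<subseteq> (\<Union>i\<in>I. {x i, y i})"
    using f_PiE i(1) by (auto dest: PiE_mem)
  then show "p \<notin> insert (y i) (f ` I)" using p by blast
  show "general_position (insert p (insert (y i) (f ` I)))"
    using gp by (rule general_position_subset) (use subset in blast)
  show "y i \<notin> f ` I"
  proof
    assume "y i \<in> f ` I"
    then obtain j where j: "j \<in> I" "f j = y i" by auto
    then have "y i \<in> {x i, y i} \<inter> {x j, y j}" using f_PiE by (auto dest: PiE_mem)
    then have "j = i" using disj i(1) j(1) unfolding disjoint_family_on_def by blast
    then show False using j(2) i(2) by simp
  qed
qed

text \<open>Sum the parity of the vertex replacements by \<open>y i\<close> over the transversals through \<open>x i\<close>, for a
  fixed colour \<open>i\<close>. Replacing a vertex of another colour \<open>j\<close> gives the same simplex for both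
  choices of that vertex, so only the replacements at \<open>i\<close> survive.\<close>

theorem even_card_octahedron_containing:
  fixes x y :: "'i \<Rightarrow> real^'n"
  assumes I: "finite I" "card I = CARD('n) + 1"
    and xy: "\<And>i. i \<in> I \<Longrightarrow> x i \<noteq> y i" and disj: "disjoint_family_on (\<lambda>i. {x i, y i}) I"
    and p: "p \<notin> (\<Union>i\<in>I. {x i, y i})" and gp: "general_position (insert p (\<Union>i\<in>I. {x i, y i}))"
  shows "even (card {f \<in> octahedron I x y. p \<in> convex hull (f ` I)})"
proof -
  obtain i where i: "i \<in> I" using I(2) by fastforce
  define Q where "Q f \<longleftrightarrow> p \<in> convex hull (f ` I)" for f :: "'i \<Rightarrow> real^'n"
  define D where "D = {f \<in> octahedron I x y. f i = x i}"
  have fin_D: "finite D" using finite_octahedron[OF I(1), of x y] by (simp add: D_def)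
  have "even (of_bool (Q f) + card {j \<in> I. Q (f(j := y i))})" if "f \<in> D" for f
    unfolding Q_def using that xy[OF i]
    by (intro even_card_vertex_replacements_in_octahedron[OF I disj p gp _ i]) (auto simp: D_def)
  then have "even (\<Sum>f\<in>D. of_bool (Q f) + card {j \<in> I. Q (f(j := y i))})"
    by (intro dvd_sum)
  also have "(\<Sum>f\<in>D. of_bool (Q f) + card {j \<in> I. Q (f(j := y i))})
      = card {f \<in> D. Q f} + (\<Sum>j\<in>I. card {f \<in> D. Q (f(j := y i))})"
    using sum_multicount_gen[OF fin_D I(1), of "\<lambda>f j. Q (f(j := y i))"] fin_D
    by (simp add: sum.distrib sum_of_bool_eq Int_def)
  also have "\<dots> = card {f \<in> octahedron I x y. Q f}
      + (\<Sum>j\<in>I - {i}. card {f \<in> D. Q (f(j := y i))})"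
    using card_octahedron_split[of I i x y Q] card_octahedron_update[of i I x y Q] I(1) i xy
    by (simp add: D_def sum.remove[OF I(1) i])
  finally have "even (card {f \<in> octahedron I x y. Q f}
      + (\<Sum>j\<in>I - {i}. card {f \<in> D. Q (f(j := y i))}))" .
  moreover have "even (\<Sum>j\<in>I - {i}. card {f \<in> D. Q (f(j := y i))})"
  proof (rule dvd_sum)
    fix j assume j: "j \<in> I - {i}"
    have "even (card {f \<in> octahedron I x y. f i = x i \<and> Q (f(j := y i))})"
      using j I(1) by (intro even_card_octahedron_invariant xy) auto
    then show "even (card {f \<in> D. Q (f(j := y i))})" by (simp add: D_def)
  qed
  ultimately show ?thesis unfolding Q_def by simp
qed

theorem octahedral_system_colourful_simplices:
  fixes S :: "'i \<Rightarrow> (real^'n) set"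
  assumes I: "finite I" "card I = CARD('n) + 1"
    and S: "\<And>i. i \<in> I \<Longrightarrow> finite (S i)" "\<And>i. i \<in> I \<Longrightarrow> card (S i) = m" "disjoint_family_on S I"
    and p: "p \<notin> (\<Union>i\<in>I. S i)" "\<And>i. i \<in> I \<Longrightarrow> p \<in> interior (convex hull (S i))"
    and gp: "general_position (insert p (\<Union>i\<in>I. S i))"
  shows "octahedral_system I S m {f \<in> Pi\<^sub>E I S. p \<in> convex hull (f ` I)}"
proof
  fix i v assume "i \<in> I" "v \<in> S i"
  then show "\<exists>e\<in>{f \<in> Pi\<^sub>E I S. p \<in> convex hull (f ` I)}. e i = v"
    using ex_colourful_simplex_at_vertex[of I i v S p] I S(1) p(2) by auto
next
  fix x y assume x: "x \<in> Pi\<^sub>E I S" and y: "y \<in> Pi\<^sub>E I S" and xy: "\<And>i. i \<in> I \<Longrightarrow> x i \<noteq> y i"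
  have pair_subset: "{x i, y i} \<subseteq> S i" if "i \<in> I" for i
    using x y that by (auto dest: PiE_mem)
  then have union_subset: "(\<Union>i\<in>I. {x i, y i}) \<subseteq> (\<Union>i\<in>I. S i)" by blast
  have "octahedron I x y \<subseteq> Pi\<^sub>E I S"
    unfolding octahedron_def using pair_subset by (intro PiE_mono)
  then have "{f \<in> Pi\<^sub>E I S. p \<in> convex hull (f ` I)} \<inter> octahedron I x y
      = {f \<in> octahedron I x y. p \<in> convex hull (f ` I)}" by blast
  also have "even (card \<dots>)"
  proof (rule even_card_octahedron_containing[OF I xy])
    show "disjoint_family_on (\<lambda>i. {x i, y i}) I"
      using S(3) pair_subset unfolding disjoint_family_on_def by blast
    show "p \<notin> (\<Union>i\<in>I. {x i, y i})" using p(1) union_subset by blast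
    show "general_position (insert p (\<Union>i\<in>I. {x i, y i}))"
      using gp by (rule general_position_subset) (use union_subset in blast)
  qed
  finally show "even (card ({f \<in> Pi\<^sub>E I S. p \<in> convex hull (f ` I)} \<inter> octahedron I x y))" .
qed (use I S in auto)

theorem theorem1:
  fixes S :: "nat \<Rightarrow> (real^'n) set" and p :: "real^'n"
  assumes card_S: "\<And>i. i \<le> CARD('n) \<Longrightarrow> finite (S i) \<and> card (S i) = CARD('n) + 1"
    and disj: "\<And>i j. i \<le> CARD('n) \<Longrightarrow> j \<le> CARD('n) \<Longrightarrow> i \<noteq> j \<Longrightarrow> S i \<inter> S j = {}"
    and p_notin: "p \<notin> (\<Union>i\<le>CARD('n). S i)"
    and gp: "general_position ((\<Union>i\<le>CARD('n). S i) \<union> {p})"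
    and p_int: "\<And>i. i \<le> CARD('n) \<Longrightarrow> p \<in> interior (convex hull (S i))"
  shows "real_of_int \<lceil>real ((CARD('n) + 1)^2) / 2\<rceil>
           \<le> real (card (colourful_simplices_containing S p))"
proof -
  let ?d = "CARD('n)" and ?E = "colourful_simplices_containing S p"
  have "octahedral_system {..?d} S (?d + 1) ?E"
    unfolding colourful_simplices_containing_def
  proof (rule octahedral_system_colourful_simplices)
    show "disjoint_family_on S {..?d}" using disj by (simp add: disjoint_family_on_def)
  qed (use card_S p_notin gp p_int in auto)
  then have "(?d + 1) * min (?d + 1) (card {..?d}) \<le> 2 * card ?E"
    by (rule octahedral_system.card_edges_ge)
  then have "real ((?d + 1)^2) / 2 \<le> real_of_int (int (card ?E))"
    by (simp add: power2_eq_square flip: of_nat_mult)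
  then have "\<lceil>real ((?d + 1)^2) / 2\<rceil> \<le> int (card ?E)"
    by (rule ceiling_le)
  then show ?thesis by linarith
qed

end
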